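(* For all $n\ge 2$: (i) $f_{2n}(2,k)=f_{2n-2}(\bullet,k-2)=f_{2n-2}(k-1,\bullet)$ for $3\le k\le 2n-1$; (ii) $f_{2n}(3,k)=3\,f_{2n}(2,k)$ for $4\le k\le 2n-1$; (iii) $f_{2n}(m,2n-1)=f_{2n-2}(m,\bullet)=f_{2n-2}(\bullet,m-1)$ for $2\le m\le 2n-2$; (iv) $f_{2n}(m,2n-2)=3\,f_{2n}(m,2n-1)$ for $2\le m\le 2n-3$.
   Context: An increasing tree of size $N$ is a planar binary tree with $N$ nodes labeled bijectively by $1,\dots,N$, the root labeled $1$, each node having $0$, $1$ or $2$ children, each child designated as a left child or a right child (at most one of each), and each node's label smaller than its children's labels. Its rightmost node is the node reached from the root by repeatedly moving to the right child until a node without right child is reached. The tree is complete if every node is either a leaf or has two children, except that when $N$ is even the rightmost node has exactly one child, which is a left child. Let $\mathfrak T_N$ be the set of complete increasing trees of size $N$. For $t\in\mathfrak T_N$: for a node $a$ with children, let $\min a$ be the smallest label of its children; the minimal chain is $a_1=1, a_2=\min a_1,\dots$, continued until a leaf $a_j$ is reached, and $\mathrm{eoc}(t):=a_j$. The node labeled $N$ is a leaf; $\mathrm{pom}(t)$ is the label of its parent. Set $f_{2n}(m,k):=\#\{t\in\mathfrak T_{2n}:\mathrm{eoc}(t)=m,\ \mathrm{pom}(t)=k\}$ (zero outside $[2,2n]\times[1,2n-1]$), $f_{2n}(m,\bullet):=\sum_k f_{2n}(m,k)$ and $f_{2n}(\bullet,k):=\sum_m f_{2n}(m,k)$. *)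

theory Defs
  imports "HOL-Library.Tree"
begin

text \<open>
  In \<^typ>\<open>'a tree\<close> the constructor \<^const>\<open>Leaf\<close> is the empty tree and only \<^const>\<open>Node\<close>s count as
  nodes: \<^term>\<open>size t\<close> is the number of nodes, and a leaf in the combinatorial sense is
  \<^term>\<open>Node Leaf a Leaf\<close>. A missing child is represented by \<^const>\<open>Leaf\<close>.
\<close>

fun child_labels :: "'a tree \<Rightarrow> 'a set" where
  "child_labels Leaf = {}"
| "child_labels (Node l a r) = value ` ({l, r} - {Leaf})"

text \<open>
  The last conjunct of the next definition, together with \<^term>\<open>size t = N\<close>, makes the labelling
  bijective.
\<close>

definition increasing_tree :: "nat \<Rightarrow> nat tree \<Rightarrow> bool" where
  "increasing_tree N t \<longleftrightarrow>
     t \<noteq> Leaf \<and> value t = 1 \<and>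
     (\<forall>l a r. Node l a r \<in> subtrees t \<longrightarrow> (\<forall>c \<in> child_labels (Node l a r). a < c)) \<and>
     size t = N \<and> set_tree t = {1..N}"

fun rightmost :: "'a tree \<Rightarrow> 'a" where
  "rightmost Leaf = undefined"
| "rightmost (Node l a r) = (if r = Leaf then a else rightmost r)"

text \<open>
  Nodes are identified by their labels, so this is meant for trees with distinct labels.
\<close>

definition complete_tree :: "'a tree \<Rightarrow> bool" where
  "complete_tree t \<longleftrightarrow>
     (\<forall>l a r. Node l a r \<in> subtrees t \<longrightarrow>
        (if even (size t) \<and> a = rightmost t then l \<noteq> Leaf \<and> r = Leaf
         else (l = Leaf \<and> r = Leaf) \<or> (l \<noteq> Leaf \<and> r \<noteq> Leaf)))"

definition CIT :: "nat \<Rightarrow> nat tree set" where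
  "CIT N = {t. increasing_tree N t \<and> complete_tree t}"

text \<open>End of the minimal chain: from each node pass to the child with the smaller label.\<close>

fun eoc :: "nat tree \<Rightarrow> nat" where
  "eoc Leaf = undefined"
| "eoc (Node l a r) =
     (if l = Leaf \<and> r = Leaf then a
      else if r = Leaf \<or> (l \<noteq> Leaf \<and> value l < value r) then eoc l
      else eoc r)"

definition pom :: "nat tree \<Rightarrow> nat" where
  "pom t = (THE k. \<exists>l r. Node l k r \<in> subtrees t \<and> size t \<in> child_labels (Node l k r))"

text \<open>
  The first argument is the size \<^term>\<open>N\<close> of the trees (always even below). For \<^term>\<open>N \<ge> 2\<close> the
  count vanishes by itself unless \<^term>\<open>m \<in> {2..N}\<close> and \<^term>\<open>k \<in> {1..N-1}\<close>, so the marginals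
  are sums over these ranges.
\<close>

definition f :: "nat \<Rightarrow> nat \<Rightarrow> nat \<Rightarrow> nat" where
  "f N m k = card {t \<in> CIT N. eoc t = m \<and> pom t = k}"

definition f_row :: "nat \<Rightarrow> nat \<Rightarrow> nat" where
  "f_row N m = (\<Sum>k = 1..N - 1. f N m k)"

definition f_col :: "nat \<Rightarrow> nat \<Rightarrow> nat" where
  "f_col N k = (\<Sum>m = 2..N. f N m k)"

text \<open>The sets counted by \<^const>\<open>f\<close> are finite, so \<^const>\<open>card\<close> is meaningful.\<close>

lemma finite_CIT: "finite (CIT N)"
proof -
  have fin: "finite {t :: nat tree. set_tree t \<subseteq> {1..N} \<and> height t \<le> h}" for h
  proof (induction h)
    case 0
    have "{t :: nat tree. set_tree t \<subseteq> {1..N} \<and> height t \<le> 0} \<subseteq> {Leaf}" by auto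
    then show ?case by (rule finite_subset) simp
  next
    case (Suc h)
    let ?S = "{t :: nat tree. set_tree t \<subseteq> {1..N} \<and> height t \<le> h}"
    let ?g = "\<lambda>(l, a, r). Node l (a :: nat) r"
    have "t \<in> insert Leaf (?g ` (?S \<times> {1..N} \<times> ?S))"
      if "set_tree t \<subseteq> {1..N}" "height t \<le> Suc h" for t
      using that by (cases t) (auto simp: image_iff)
    then have "{t :: nat tree. set_tree t \<subseteq> {1..N} \<and> height t \<le> Suc h}
        \<subseteq> insert Leaf (?g ` (?S \<times> {1..N} \<times> ?S))" by blast
    then show ?case by (rule finite_subset) (use Suc.IH in simp)
  qed
  have "CIT N \<subseteq> {t. set_tree t \<subseteq> {1..N} \<and> height t \<le> N}"
    using height_le_size_tree by (auto simp: CIT_def increasing_tree_def)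
  then show ?thesis using fin by (rule finite_subset)
qed

end

theory Submission
  imports Defs
begin

text \<open>
  Removing the smallest label from an increasing tree leaves a sequence of trees, so one counts
  sequences of \<^term>\<open>p\<close> complete trees of odd size followed by one tree of even (possibly zero) size.
  Removing the smallest label again changes \<^term>\<open>p\<close> by one, upwards in \<^term>\<open>p + 1\<close> ways (the label
  had children) and downwards in \<^term>\<open>p\<close> ways (it was a leaf). This is the operator \<open>W\<close> below. If the
  label removed is the parent of the largest label, that label is removed along with it, in
  \<^term>\<open>2 * p + 1\<close> ways, which is the operator \<open>D\<close>. Hence \<open>pom = k\<close> is counted by
  \<open>W\<^sup>k\<^sup>-\<^sup>1 D W\<^sup>N\<^sup>-\<^sup>1\<^sup>-\<^sup>k\<close>.
  For the minimal chain one marks the two adjacent trees that hang from its current last node.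
  Summing over all positions of the mark, the counts again evolve by \<open>W\<close>, and the end of the chain
  contributes \<open>D\<close>. Hence \<open>eoc = m\<close> is counted by \<open>W\<^sup>m\<^sup>-\<^sup>2 D W\<^sup>N\<^sup>-\<^sup>m\<close>, and \<open>eoc = m, pom = k\<close> with \<open>m < k\<close> by
  \<open>W\<^sup>m\<^sup>-\<^sup>2 D W\<^sup>k\<^sup>-\<^sup>m\<^sup>-\<^sup>1 D W\<^sup>N\<^sup>-\<^sup>1\<^sup>-\<^sup>k\<close>. Here the operators act on the
  indicator \<open>e\<^sub>0\<close> of the empty sequence and the result is evaluated at \<open>0\<close>. All four identities are
  read off from these formulas.
\<close>

section \<open>Forests of complete trees and the two ways to insert a label\<close>

fun full :: "'a tree \<Rightarrow> bool" where
  "full Leaf = False"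
| "full (Node l a r) = (l = Leaf \<and> r = Leaf \<or> full l \<and> full r)"

text \<open>
  A \<^const>\<open>full\<close> tree has odd size; the next predicate describes the complete trees of even size,
  where the rightmost node has only a left child, together with the empty tree.
\<close>

fun secant_shape :: "'a tree \<Rightarrow> bool" where
  "secant_shape Leaf = True"
| "secant_shape (Node l a r) = (full l \<and> secant_shape r)"

fun shape_ok :: "'a tree list \<Rightarrow> bool" where
  "shape_ok [] = False"
| "shape_ok (t # ts) = (if ts = [] then secant_shape t else full t \<and> shape_ok ts)"

definition labels :: "'a tree list \<Rightarrow> 'a list" where
  "labels ts = concat (map inorder ts)"

text \<open>The index \<open>p\<close> counts the full trees; the last tree, possibly
  \<open>Leaf\<close>, is always present, whence \<open>Suc p\<close>. The order in
  \<open>heap\<close> is weak and becomes strict because labels are distinct.\<close>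

definition forests :: "nat \<Rightarrow> nat set \<Rightarrow> nat tree list set" where
  "forests p A = {ts. length ts = Suc p \<and> shape_ok ts \<and> (\<forall>t \<in> set ts. heap t) \<and>
     distinct (labels ts) \<and> set (labels ts) = A}"

definition ins_leaf :: "'a \<Rightarrow> nat \<Rightarrow> 'a tree list \<Rightarrow> 'a tree list" where
  "ins_leaf a j ts = take j ts @ Node Leaf a Leaf # drop j ts"

definition ins_node :: "'a \<Rightarrow> nat \<Rightarrow> 'a tree list \<Rightarrow> 'a tree list" where
  "ins_node a j ts = take j ts @ Node (ts ! j) a (ts ! Suc j) # drop (Suc (Suc j)) ts"

lemma labels_simps [simp]:
  "labels [] = []" "labels (t # ts) = inorder t @ labels ts"
  "labels (ts @ us) = labels ts @ labels us"
  by (auto simp: labels_def)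

lemma shape_ok_append [simp]:
  "us \<noteq> [] \<Longrightarrow> shape_ok (ts @ us) \<longleftrightarrow> (\<forall>t \<in> set ts. full t) \<and> shape_ok us"
  by (induction ts) auto

lemma ins_leaf_append [simp]: "ins_leaf a (length xs) (xs @ ys) = xs @ Node Leaf a Leaf # ys"
  by (simp add: ins_leaf_def)

lemma ins_node_append [simp]:
  "ins_node a (length xs) (xs @ l # r # ys) = xs @ Node l a r # ys"
  by (simp add: ins_node_def nth_append)

lemma split_one:
  assumes "j \<le> length ts"
  obtains xs ys where "ts = xs @ ys" "length xs = j"
  using assms by (metis append_take_drop_id length_take min_absorb2)

lemma split_two:
  assumes "Suc j < length ts"
  obtains xs l r ys where "ts = xs @ l # r # ys" "length xs = j"
proof
  show "ts = take j ts @ ts ! j # ts ! Suc j # drop (Suc (Suc j)) ts"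
    using assms by (simp add: Cons_nth_drop_Suc)
  show "length (take j ts) = j" using assms by simp
qed

lemma ins_leaf_nth:
  assumes "j \<le> length ts" "i \<le> length ts"
  shows "ins_leaf a j ts ! i =
    (if i < j then ts ! i else if i = j then Node Leaf a Leaf else ts ! (i - 1))"
  using assms by (auto simp: ins_leaf_def nth_append nth_Cons' min_def)

lemma ins_node_nth:
  assumes "Suc j < length ts" "Suc i < length ts"
  shows "ins_node a j ts ! i =
    (if i < j then ts ! i else if i = j then Node (ts ! j) a (ts ! Suc j) else ts ! Suc i)"
  using assms by (auto simp: ins_node_def nth_append nth_Cons' min_def)

lemma forests_length: "ts \<in> forests p A \<Longrightarrow> length ts = Suc p"
  by (simp add: forests_def)

lemma shape_ok_full:
  "shape_ok ts \<Longrightarrow> Suc i < length ts \<Longrightarrow> full (ts ! i)"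
  by (induction ts arbitrary: i) (auto simp: nth_Cons' split: if_splits)

lemma forests_full:
  assumes "ts \<in> forests p A" "i < p"
  shows "full (ts ! i)"
  using assms by (auto simp: forests_def intro: shape_ok_full)

lemma forests_set_tree:
  assumes "ts \<in> forests p A" "i \<le> p"
  shows "set_tree (ts ! i) \<subseteq> A"
proof -
  have "ts ! i \<in> set ts" using assms by (simp add: forests_def)
  then have "set_tree (ts ! i) \<subseteq> set (labels ts)" by (auto simp: labels_def)
  then show ?thesis using assms by (simp add: forests_def)
qed

text \<open>Only freshness of \<open>a\<close> is assumed, so that the largest label can be inserted
  as well. The bound \<open>j \<le> p\<close> keeps the single node out of the last place.\<close>

lemma ins_leaf_forests:
  assumes "ts \<in> forests p A" "j \<le> p" "a \<notin> A"
  shows "ins_leaf a j ts \<in> forests (Suc p) (insert a A)"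
proof -
  obtain xs ys where ts: "ts = xs @ ys" "length xs = j"
    using split_one[of j ts] assms by (auto simp: forests_def)
  have "ys \<noteq> []" using ts assms(1,2) by (auto simp: forests_def)
  moreover have "ins_leaf a j ts = xs @ Node Leaf a Leaf # ys" using ts by auto
  moreover have "xs @ ys \<in> forests p A" using ts assms by simp
  ultimately show ?thesis using assms(3) by (simp add: forests_def) blast
qed

lemma ins_node_forests:
  assumes "ts \<in> forests (Suc p) A" "j \<le> p" "\<forall>x \<in> A. a < x"
  shows "ins_node a j ts \<in> forests p (insert a A)"
proof -
  have "Suc j < length ts" using assms by (simp add: forests_length)
  from split_two[OF this] obtain xs l r ys where ts: "ts = xs @ l # r # ys" "length xs = j" .
  have "set_tree l \<subseteq> A" "set_tree r \<subseteq> A"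
    using assms unfolding ts(1) by (auto simp: forests_def)
  then have "\<forall>x \<in> set_tree l \<union> set_tree r. a \<le> x" using assms(3) by fastforce
  moreover have "a \<notin> A" using assms(3) by auto
  moreover have "ins_node a j ts = xs @ Node l a r # ys" using ts by auto
  moreover have "xs @ l # r # ys \<in> forests (Suc p) A" using ts assms by simp
  ultimately show ?thesis by (simp add: forests_def split: if_splits) blast+
qed

section \<open>Decomposition of forests by the smallest label\<close>

lemma heap_root_min:
  assumes "heap t" "a \<in> set_tree t" "\<forall>x \<in> set_tree t. a \<le> x"
  obtains l r where "t = Node l a r"
  using assms by (cases t) (auto simp: antisym)

text \<open>The smallest label sits at the root of its tree, and deleting it either deletes a single
  node or leaves two adjacent subtrees. In the last place the left subtree is full, so no single
  node occurs there, and the right subtree becomes the new last tree.\<close>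

lemma forests_insert_cases:
  assumes ts: "ts \<in> forests p (insert a A)" and a: "\<forall>x \<in> A. a < x"
  obtains (leaf) us j where "j < p" "us \<in> forests (p - 1) A" "ts = ins_leaf a j us"
  | (node) us j where "j \<le> p" "us \<in> forests (Suc p) A" "ts = ins_node a j us"
proof -
  have "a \<in> set (labels ts)" using ts by (simp add: forests_def)
  then obtain t where t: "t \<in> set ts" "a \<in> set_tree t" by (auto simp: labels_def)
  have "set_tree t \<subseteq> insert a A" using ts t(1) by (auto simp: forests_def labels_def)
  then have "\<forall>x \<in> set_tree t. a \<le> x" using a by fastforce
  then obtain l r where lr: "t = Node l a r"
    using heap_root_min[of t a] ts t by (auto simp: forests_def)
  obtain xs ys where split: "ts = xs @ Node l a r # ys"
    using t(1) lr split_list by fast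
  have notin: "a \<notin> A" using a by auto
  have lab: "set (labels xs) \<union> set_tree l \<union> set_tree r \<union> set (labels ys) = A"
    using ts notin unfolding split by (auto simp: forests_def)
  show ?thesis
  proof (cases "l = Leaf \<and> ys \<noteq> []")
    case True
    then have r: "r = Leaf" using ts unfolding split by (auto simp: forests_def)
    show ?thesis
    proof (rule leaf)
      show "length xs < p" using ts True unfolding split by (cases ys) (auto simp: forests_def)
      show "xs @ ys \<in> forests (p - 1) A"
        using ts True r lab unfolding split by (auto simp: forests_def)
      show "ts = ins_leaf a (length xs) (xs @ ys)" using split True r by simp
    qed
  next
    case False
    show ?thesis
    proof (rule node)
      show "length xs \<le> p" using ts unfolding split by (auto simp: forests_def)
      show "xs @ l # r # ys \<in> forests (Suc p) A"
        using ts False lab unfolding split by (auto simp: forests_def)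
      show "ts = ins_node a (length xs) (xs @ l # r # ys)" using split by simp
    qed
  qed
qed

lemma root_index_unique:
  assumes "distinct (labels ts)" "i < length ts" "j < length ts"
    and "a \<in> set_tree (ts ! i)" "a \<in> set_tree (ts ! j)"
  shows "i = j"
  using assms
proof (induction ts arbitrary: i j)
  case (Cons t ts)
  have "set_tree (ts ! k) \<subseteq> set (labels ts)" if "k < length ts" for k
    using nth_mem[OF that] by (auto simp: labels_def)
  then show ?case using Cons by (cases i; cases j) (auto; blast)+
qed simp

lemma inj_ins_leaf: "inj_on (ins_leaf a j) (forests p A)"
proof (rule inj_onI)
  fix ts us assume *: "ts \<in> forests p A" "us \<in> forests p A" "ins_leaf a j ts = ins_leaf a j us"
  then have "length ts = length us" by (simp add: forests_def)
  then show "ts = us" using *(3)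
    by (auto simp: ins_leaf_def dest: append_eq_append_conv[THEN iffD1, rotated])
       (metis append_take_drop_id)
qed

lemma inj_ins_node:
  assumes "j \<le> p"
  shows "inj_on (ins_node a j) (forests (Suc p) A)"
proof (rule inj_onI)
  fix ts us assume *: "ts \<in> forests (Suc p) A" "us \<in> forests (Suc p) A"
    "ins_node a j ts = ins_node a j us"
  then have len: "length ts = Suc (Suc p)" "length us = Suc (Suc p)" by (auto simp: forests_def)
  then have "Suc j < length ts" "Suc j < length us" using assms by auto
  from split_two[OF this(1)] split_two[OF this(2)]
  obtain xs l r ys xs' l' r' ys' where ts: "ts = xs @ l # r # ys" "length xs = j"
    and us: "us = xs' @ l' # r' # ys'" "length xs' = j" by metis
  have "xs @ Node l a r # ys = xs' @ Node l' a r' # ys'"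
    using *(3) ts us ins_node_append by metis
  then show "ts = us" using ts us by auto
qed

text \<open>Without labels all trees are empty, and only the last place admits an empty tree. Every
  count bottoms out here, in the form of \<open>e\<^sub>0\<close>.\<close>

lemma forests_empty: "forests p {} = (if p = 0 then {[Leaf]} else {})"
proof -
  have "ts = [Leaf] \<and> p = 0" if "ts \<in> forests p {}" for ts
  proof -
    have *: "t = Leaf" if "t \<in> set ts" for t
      using that \<open>ts \<in> forests p {}\<close> by (auto simp: forests_def labels_def)
    then have "\<not> 0 < p" using forests_full[OF that, of 0] that
      by (metis forests_length full.simps(1) nth_mem zero_less_Suc)
    then show ?thesis using that * by (cases ts) (auto simp: forests_def)
  qed
  moreover have "[Leaf] \<in> forests 0 {}" by (simp add: forests_def)
  ultimately have "forests p {} = {ts. p = 0 \<and> ts = [Leaf]}" by blast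
  then show ?thesis by auto
qed

text \<open>At \<open>p = 0\<close> the truncated \<open>p - 1\<close> is harmless, since the first
  union is then empty.\<close>

lemma forests_insert_eq:
  assumes "\<forall>x \<in> A. a < x"
  shows "forests p (insert a A) =
    (\<Union>j<p. ins_leaf a j ` forests (p - 1) A) \<union> (\<Union>j\<le>p. ins_node a j ` forests (Suc p) A)"
    (is "?L = ?R")
proof
  show "?L \<subseteq> ?R"
  proof
    fix ts assume "ts \<in> ?L"
    then show "ts \<in> ?R" using assms by (cases rule: forests_insert_cases) auto
  qed
  have "a \<notin> A" using assms by auto
  then have "ins_leaf a j ts \<in> ?L" if "j < p" "ts \<in> forests (p - 1) A" for j ts
    using ins_leaf_forests[of ts "p - 1" A j a] that by simp
  then show "?R \<subseteq> ?L" using ins_node_forests[OF _ _ assms] by auto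
qed

lemma finite_forests: "finite (forests p {a..<b})"
proof (induction "b - a" arbitrary: p a)
  case 0
  then show ?case by (simp add: forests_empty)
next
  case (Suc n)
  then have "{a..<b} = insert a {Suc a..<b}" by auto
  moreover have "finite (forests q {Suc a..<b})" for q using Suc by simp
  ultimately show ?case by (simp add: forests_insert_eq)
qed

text \<open>The label \<open>a\<close> occurs in one tree only, whose position recovers
  \<open>j\<close>; a full left subtree tells a joining node from an inserted leaf. Hence the images
  are disjoint. The free predicate \<open>R\<close> lets one step serve both \<open>pom\<close> and
  \<open>eoc\<close>.\<close>

lemma card_forests_step:
  assumes ab: "a < b"
  shows "card {ts \<in> forests p {a..<b}. R ts} =
    (\<Sum>j<p. card {ts \<in> forests (p - 1) {Suc a..<b}. R (ins_leaf a j ts)}) +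
    (\<Sum>j\<le>p. card {ts \<in> forests (Suc p) {Suc a..<b}. R (ins_node a j ts)})"
proof -
  let ?A = "{Suc a..<b}"
  define L where "L j = ins_leaf a j ` {ts \<in> forests (p - 1) ?A. R (ins_leaf a j ts)}" for j
  define I where "I j = ins_node a j ` {ts \<in> forests (Suc p) ?A. R (ins_node a j ts)}" for j
  have ins: "{a..<b} = insert a ?A" using ab by auto
  have lt: "\<forall>x \<in> ?A. a < x" by auto
  have eq: "{ts \<in> forests p {a..<b}. R ts} = (\<Union>j<p. L j) \<union> (\<Union>j\<le>p. I j)"
    unfolding ins forests_insert_eq[OF lt] L_def I_def by blast
  have fin: "finite (L j)" "finite (I j)" for j
    by (auto simp: L_def I_def finite_forests)
  have Lnth: "ts ! j = Node Leaf a Leaf" "ts \<in> forests p {a..<b}" if "ts \<in> L j" "j < p" for ts j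
    using that ins_leaf_forests[of _ "p - 1" ?A j a] unfolding ins
    by (auto simp: L_def ins_leaf_nth forests_length)
  have Inth: "\<exists>l r. full l \<and> ts ! j = Node l a r" "ts \<in> forests p {a..<b}"
    if "ts \<in> I j" "j \<le> p" for ts j
    using that ins_node_forests[of _ p ?A j a] unfolding ins
    by (auto simp: I_def ins_node_nth forests_length forests_full[where p = "Suc p"])
  have uniq: "i = j" if "ts \<in> forests p {a..<b}" "i \<le> p" "j \<le> p"
    "a \<in> set_tree (ts ! i)" "a \<in> set_tree (ts ! j)" for ts i j
    using that root_index_unique[of ts i j a] by (auto simp: forests_def)
  have LL: "L i \<inter> L j = {}" if "i < p" "j < p" "i \<noteq> j" for i j
    using that uniq[of _ i j] Lnth[of _ i] Lnth[of _ j] by fastforce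
  have II: "I i \<inter> I j = {}" if "i \<le> p" "j \<le> p" "i \<noteq> j" for i j
    using that uniq[of _ i j] Inth[of _ i] Inth[of _ j] by fastforce
  have LI: "L i \<inter> I j = {}" if "i < p" "j \<le> p" for i j
  proof -
    have False if "ts \<in> L i" "ts \<in> I j" for ts
    proof -
      note t = Lnth[OF that(1) \<open>i < p\<close>] Inth[OF that(2) \<open>j \<le> p\<close>]
      then have "i = j" using uniq[of ts i j] \<open>i < p\<close> \<open>j \<le> p\<close> by fastforce
      then show False using t by auto
    qed
    then show ?thesis by blast
  qed
  have "card {ts \<in> forests p {a..<b}. R ts} = card (\<Union>j<p. L j) + card (\<Union>j\<le>p. I j)"
    unfolding eq using LI fin by (intro card_Un_disjoint) auto
  also have "card (\<Union>j<p. L j) = (\<Sum>j<p. card (L j))"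
    using LL fin by (intro card_UN_disjoint) auto
  also have "card (\<Union>j\<le>p. I j) = (\<Sum>j\<le>p. card (I j))"
    using II fin by (intro card_UN_disjoint) auto
  also have "(\<Sum>j<p. card (L j)) =
      (\<Sum>j<p. card {ts \<in> forests (p - 1) ?A. R (ins_leaf a j ts)})"
    unfolding L_def by (intro sum.cong refl card_image inj_on_subset[OF inj_ins_leaf]) auto
  also have "(\<Sum>j\<le>p. card (I j)) =
      (\<Sum>j\<le>p. card {ts \<in> forests (Suc p) ?A. R (ins_node a j ts)})"
    unfolding I_def by (intro sum.cong refl card_image inj_on_subset[OF inj_ins_node]) auto
  finally show ?thesis .
qed

section \<open>The counting operators and their iteration\<close>

definition W :: "(nat \<Rightarrow> nat) \<Rightarrow> nat \<Rightarrow> nat" where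
  "W v p = (p + 1) * v (p + 1) + p * v (p - 1)"

definition D :: "(nat \<Rightarrow> nat) \<Rightarrow> nat \<Rightarrow> nat" where
  "D v p = (2 * p + 1) * v p"

definition e\<^sub>0 :: "nat \<Rightarrow> nat" where
  "e\<^sub>0 p = (if p = 0 then 1 else 0)"

text \<open>Such conditions pass unchanged through the removal of \<open>a\<close>, so that counts
  restricted to \<open>Q\<close> obey the same recursion as unrestricted ones. The bounds on
  \<open>j\<close> match those in \<open>card_forests_step\<close>.\<close>

definition removable :: "nat tree list set \<Rightarrow> nat \<Rightarrow> bool" where
  "removable Q a \<longleftrightarrow> (\<forall>ts j. (j < length ts \<longrightarrow> (ins_leaf a j ts \<in> Q \<longleftrightarrow> ts \<in> Q)) \<and>
     (Suc j < length ts \<longrightarrow> (ins_node a j ts \<in> Q \<longleftrightarrow> ts \<in> Q)))"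

lemma removable_UNIV: "removable UNIV a"
  by (simp add: removable_def)

text \<open>There are \<open>p\<close> places for a leaf and \<open>p + 1\<close> adjacent pairs to
  join, and \<open>Q\<close> ignores \<open>a\<close>, so all summands of one kind agree.\<close>

lemma card_forests_removable:
  assumes "a < b" "removable Q a"
  shows "card (forests p {a..<b} \<inter> Q) = W (\<lambda>p. card (forests p {Suc a..<b} \<inter> Q)) p"
proof -
  have "{ts \<in> forests (p - 1) {Suc a..<b}. ins_leaf a j ts \<in> Q} =
      forests (p - 1) {Suc a..<b} \<inter> Q" if "j < p" for j
    using assms that by (auto simp: removable_def forests_length)
  moreover have "{ts \<in> forests (Suc p) {Suc a..<b}. ins_node a j ts \<in> Q} =
      forests (Suc p) {Suc a..<b} \<inter> Q" if "j \<le> p" for j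
    using assms that by (auto simp: removable_def forests_length)
  moreover have "forests p {a..<b} \<inter> Q = {ts \<in> forests p {a..<b}. ts \<in> Q}" by auto
  ultimately show ?thesis
    using card_forests_step[OF assms(1), of p "\<lambda>ts. ts \<in> Q"] by (simp add: W_def)
qed

lemma card_forests_removable_power:
  assumes "a \<le> c" "c \<le> b" "\<forall>x \<in> {a..<c}. removable Q x"
  shows "card (forests p {a..<b} \<inter> Q) = (W ^^ (c - a)) (\<lambda>p. card (forests p {c..<b} \<inter> Q)) p"
  using assms
proof (induction "c - a" arbitrary: a p)
  case (Suc n)
  have "card (forests p {a..<b} \<inter> Q) = W (\<lambda>p. card (forests p {Suc a..<b} \<inter> Q)) p"
    using Suc by (intro card_forests_removable) auto
  also have "\<dots> = W (\<lambda>p. (W ^^ n) (\<lambda>p. card (forests p {c..<b} \<inter> Q)) p) p"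
    using Suc.hyps(1)[of "Suc a"] Suc.hyps(2) Suc.prems
    by (auto simp: W_def eq_diff_iff le_diff_conv split: nat_diff_split)
  finally show ?case by (simp flip: Suc.hyps(2))
qed simp

text \<open>If \<open>b < a\<close>, the interval is empty and the truncated difference is
  \<open>0\<close>, so both sides reduce to \<open>e\<^sub>0\<close>.\<close>

lemma card_forests: "card (forests p {a..<b}) = (W ^^ (b - a)) e\<^sub>0 p"
proof (cases "a \<le> b")
  case True
  have "(\<lambda>p. card (forests p {b..<b} \<inter> UNIV)) = e\<^sub>0"
    by (auto simp: forests_empty e\<^sub>0_def fun_eq_iff)
  then show ?thesis
    using card_forests_removable_power[OF True, of b UNIV p] removable_UNIV by simp
qed (auto simp: forests_empty e\<^sub>0_def)


section \<open>The parent of the largest label\<close>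

fun parent :: "'a tree \<Rightarrow> 'a \<Rightarrow> 'a \<Rightarrow> bool" where
  "parent Leaf k c = False"
| "parent (Node l a r) k c \<longleftrightarrow>
     k = a \<and> c \<in> child_labels (Node l a r) \<or> parent l k c \<or> parent r k c"

lemma parent_iff: "parent t k c \<longleftrightarrow> (\<exists>l r. Node l k r \<in> subtrees t \<and> c \<in> child_labels (Node l k r))"
  by (induction t) (auto simp del: child_labels.simps)

lemma child_labels_iff:
  "c \<in> child_labels (Node l a r) \<longleftrightarrow>
    (\<exists>l' r'. l = Node l' c r') \<or> (\<exists>l' r'. r = Node l' c r')"
proof -
  have "t \<noteq> Leaf \<and> c = value t \<longleftrightarrow> (\<exists>l' r'. t = Node l' c r')" for t :: "'a tree"
    by (cases t) auto
  then show ?thesis by auto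
qed

lemma parent_in_set: "parent t k c \<Longrightarrow> k \<in> set_tree t \<and> c \<in> set_tree t"
  by (induction t) (auto simp: child_labels_iff simp del: child_labels.simps)

definition has_parent :: "'a \<Rightarrow> 'a \<Rightarrow> 'a tree list set" where
  "has_parent c k = {ts. \<exists>t \<in> set ts. parent t k c}"

lemma has_parent_labels: "ts \<in> has_parent c k \<Longrightarrow> k \<in> set (labels ts)"
  by (auto simp: has_parent_def labels_def dest: parent_in_set)

lemma ins_node_has_parent:
  assumes "Suc j < length ts"
  shows "ins_node a j ts \<in> has_parent c k \<longleftrightarrow>
    ts \<in> has_parent c k \<or> k = a \<and> c \<in> child_labels (Node (ts ! j) a (ts ! Suc j))"
proof -
  obtain xs l r ys where ts: "ts = xs @ l # r # ys" "length xs = j"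
    using split_two[OF assms] .
  have "ins_node a j ts = xs @ Node l a r # ys" using ts by auto
  moreover have "ts ! j = l" "ts ! Suc j = r" using ts by (auto simp: nth_append)
  ultimately show ?thesis by (auto simp: has_parent_def ts(1) simp del: child_labels.simps)
qed

lemma ins_leaf_has_parent: "ins_leaf a j ts \<in> has_parent c k \<longleftrightarrow> ts \<in> has_parent c k"
proof -
  have "ts \<in> has_parent c k \<longleftrightarrow> take j ts @ drop j ts \<in> has_parent c k" by simp
  then show ?thesis by (auto simp: has_parent_def ins_leaf_def simp del: append_take_drop_id)
qed

text \<open>Inserting \<open>a\<close> creates only edges that start at \<open>a\<close> and keeps
  all others.\<close>

lemma removable_has_parent:
  assumes "a \<noteq> k"
  shows "removable (has_parent c k) a"
  using assms by (simp add: removable_def ins_leaf_has_parent ins_node_has_parent)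

text \<open>Nothing can lie below the largest label, so it has no children; a single node in the
  last place would violate \<open>secant_shape\<close>.\<close>

lemma max_is_leaf:
  assumes ts: "ts \<in> forests p {a..<Suc N}" and i: "i \<le> p" "ts ! i = Node l N r"
  shows "i < p \<and> l = Leaf \<and> r = Leaf"
proof -
  have mem: "ts ! i \<in> set ts" using ts i(1) by (simp add: forests_def)
  have sub: "set_tree (ts ! i) \<subseteq> {a..<Suc N}" using forests_set_tree[OF ts i(1)] .
  have heap: "heap (ts ! i)" "distinct (inorder (ts ! i))"
    using ts mem by (auto simp: forests_def labels_def distinct_concat_iff)
  have "x = N" if "x \<in> set_tree l \<union> set_tree r" for x
  proof (rule antisym)
    show "N \<le> x" using that heap(1) unfolding i(2) by auto
    have "x \<in> set_tree (ts ! i)" using that by (auto simp: i(2))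
    then show "x \<le> N" using sub by auto
  qed
  moreover have "N \<notin> set_tree l \<union> set_tree r" using heap(2) unfolding i(2) by auto
  ultimately have "set_tree l = {}" "set_tree r = {}" by blast+
  then have lr: "l = Leaf" "r = Leaf" by (simp_all add: eq_set_tree_empty)
  have "i \<noteq> p"
  proof
    assume "i = p"
    then obtain xs where "ts = xs @ [Node Leaf N Leaf]"
      using ts i lr by (metis forests_length append_butlast_last_id diff_Suc_1 last_conv_nth
          length_0_conv nat.distinct(1))
    then show False using ts by (auto simp: forests_def)
  qed
  then show ?thesis using i(1) lr by simp
qed

text \<open>Deleting the single-node tree is inverse to \<open>ins_leaf N i\<close>. Here the
  largest label is removed ahead of the smaller ones.\<close>

lemma card_forests_max_at:
  assumes "i \<le> p" "a \<le> N"
  shows "card {ts \<in> forests (Suc p) {a..<Suc N}. ts ! i = Node Leaf N Leaf} =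
    card (forests p {a..<N})"
proof -
  have ins: "{a..<Suc N} = insert N {a..<N}" using assms by auto
  have "{ts \<in> forests (Suc p) {a..<Suc N}. ts ! i = Node Leaf N Leaf} =
    ins_leaf N i ` forests p {a..<N}" (is "?L = ?R")
  proof
    show "?R \<subseteq> ?L" unfolding ins using assms ins_leaf_forests
      by (auto simp: ins_leaf_nth forests_length)
    show "?L \<subseteq> ?R"
    proof
      fix ts assume ts: "ts \<in> ?L"
      then have "Suc i < length ts" using assms by (auto simp: forests_length)
      from split_two[OF this] obtain xs l r ys where sp: "ts = xs @ l # r # ys" "length xs = i" .
      then have l: "l = Node Leaf N Leaf" using ts by auto
      have "xs @ r # ys \<in> forests p {a..<N}"
      proof -
        have "{a..<N} = set (labels ts) - {N}" using ts assms by (auto simp: forests_def)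
        also have "\<dots> = set (labels (xs @ r # ys))"
          using ts unfolding sp(1) l by (auto simp: forests_def)
        finally show ?thesis using ts unfolding sp(1) l by (auto simp: forests_def)
      qed
      moreover have "ts = ins_leaf N i (xs @ r # ys)" using sp l by auto
      ultimately show "ts \<in> ?R" by blast
    qed
  qed
  then show ?thesis by (simp add: card_image inj_ins_leaf)
qed

text \<open>The edge from \<open>k\<close> to \<open>N\<close> arises when \<open>k\<close> joins
  two trees one of which is the single node \<open>N\<close>. Each of the \<open>p + 1\<close>
  adjacent pairs offers two sides for \<open>N\<close>, except that the last pair offers only its
  left side. This is the origin of \<open>2 * p + 1\<close>.\<close>

lemma card_forests_parent_min:
  assumes "k < N"
  shows "card (forests p {k..<Suc N} \<inter> has_parent N k) = D ((W ^^ (N - 1 - k)) e\<^sub>0) p"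
proof -
  let ?A = "{Suc k..<Suc N}"
  let ?c = "card (forests p {Suc k..<N})"
  define M where "M i = {ts \<in> forests (Suc p) ?A. ts ! i = Node Leaf N Leaf}" for i
  \<comment> \<open>The label \<open>k\<close> is absent here, so only its own insertion can create
    the edge.\<close>
  have no: "ts \<notin> has_parent N k" if "ts \<in> forests q ?A" for q ts
    using that has_parent_labels[of ts N k] by (auto simp: forests_def)
  have leaf: "{ts \<in> forests (p - 1) ?A. ins_leaf k j ts \<in> has_parent N k} = {}" for j
    using no by (auto simp: ins_leaf_has_parent)
  have node: "{ts \<in> forests (Suc p) ?A. ins_node k j ts \<in> has_parent N k} = M j \<union> M (Suc j)"
    if "j \<le> p" for j
    using that no max_is_leaf[of _ "Suc p" "Suc k" N j] max_is_leaf[of _ "Suc p" "Suc k" N "Suc j"]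
    by (auto simp: M_def ins_node_has_parent forests_length child_labels_iff
        simp del: child_labels.simps)
  have cM: "card (M i) = ?c" if "i \<le> p" for i
    unfolding M_def using card_forests_max_at[OF that, of "Suc k" N] assms by simp
  have disj: "M j \<inter> M (Suc j) = {}" if "j < p" for j
    using that root_index_unique[of _ j "Suc j" N] by (fastforce simp: M_def forests_def)
  have M_last: "M (Suc p) = {}"
    using max_is_leaf[of _ "Suc p" "Suc k" N "Suc p"] by (auto simp: M_def)
  have finM: "finite (M i)" for i by (simp add: M_def finite_forests)
  have card_node: "card (M j \<union> M (Suc j)) = (if j = p then ?c else 2 * ?c)" if "j \<le> p" for j
    using that cM[of j] cM[of "Suc j"] disj[of j] M_last by (auto simp: card_Un_disjoint finM)
  have "card (forests p {k..<Suc N} \<inter> has_parent N k) =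
      card {ts \<in> forests p {k..<Suc N}. ts \<in> has_parent N k}"
    by (simp add: Int_def)
  also have "\<dots> =
      (\<Sum>j<p. card {ts \<in> forests (p - 1) ?A. ins_leaf k j ts \<in> has_parent N k}) +
      (\<Sum>j\<le>p. card {ts \<in> forests (Suc p) ?A. ins_node k j ts \<in> has_parent N k})"
    using assms by (intro card_forests_step) simp
  also have "\<dots> = (\<Sum>j\<le>p. card (M j \<union> M (Suc j)))"
    unfolding leaf by (simp add: node)
  also have "\<dots> = (\<Sum>j\<le>p. if j = p then ?c else 2 * ?c)"
    using card_node by simp
  also have "\<dots> = (2 * p + 1) * ?c" by (simp add: lessThan_Suc_atMost[symmetric])
  also have "?c = (W ^^ (N - 1 - k)) e\<^sub>0 p" by (simp add: card_forests)
  finally show ?thesis by (simp add: D_def)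
qed

text \<open>Labels below \<open>k\<close> are removed by \<open>W\<close>; removing \<open>k\<close>
  together with \<open>N\<close> leaves the labels \<open>k + 1\<close> to
  \<open>N - 1\<close>.\<close>

lemma card_forests_parent:
  assumes "a \<le> k" "k < N"
  shows "card (forests p {a..<Suc N} \<inter> has_parent N k) =
    (W ^^ (k - a)) (D ((W ^^ (N - 1 - k)) e\<^sub>0)) p"
proof -
  have "(\<lambda>p. card (forests p {k..<Suc N} \<inter> has_parent N k)) = D ((W ^^ (N - 1 - k)) e\<^sub>0)"
    using card_forests_parent_min[OF assms(2)] by auto
  then show ?thesis
    using card_forests_removable_power[of a k "Suc N" "has_parent N k" p] assms
    by (simp add: removable_has_parent)
qed

section \<open>The end of the minimal chain, followed through a marked pair\<close>

abbreviation eoc_pair :: "nat tree list \<Rightarrow> nat \<Rightarrow> nat" where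
  "eoc_pair ts i \<equiv> eoc (Node (ts ! i) 0 (ts ! Suc i))"

lemma eoc_in_set: "t \<noteq> Leaf \<Longrightarrow> eoc t \<in> set_tree t"
  by (induction t) auto

text \<open>This justifies the dummy root \<open>0\<close> in \<open>eoc_pair\<close>.\<close>

lemma eoc_root_irrelevant: "l \<noteq> Leaf \<Longrightarrow> eoc (Node l a r) = eoc (Node l b r)"
  by simp

lemma full_not_Leaf: "full t \<Longrightarrow> t \<noteq> Leaf"
  by auto

lemma forests_value:
  assumes "ts \<in> forests p A" "i \<le> p" "ts ! i \<noteq> Leaf"
  shows "value (ts ! i) \<in> A"
  using forests_set_tree[OF assms(1,2)] assms(3) by (cases "ts ! i") auto

lemma eoc_pair_in:
  assumes "ts \<in> forests p A" "i < p"
  shows "eoc_pair ts i \<in> A"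
proof -
  have l: "ts ! i \<noteq> Leaf" using full_not_Leaf[OF forests_full[OF assms]] .
  have "eoc_pair ts i \<in> set_tree (ts ! i) \<union> set_tree (ts ! Suc i)"
    using l eoc_in_set[of "ts ! i"] eoc_in_set[of "ts ! Suc i"] by auto
  then show ?thesis
    using forests_set_tree[OF assms(1), of i] forests_set_tree[OF assms(1), of "Suc i"] assms(2)
    by auto
qed

text \<open>A new leaf inside the marked pair has the smaller root label and ends the chain at once.
  Anywhere else it only shifts positions.\<close>

lemma eoc_pair_ins_leaf:
  assumes ts: "ts \<in> forests (p - 1) A" and A: "\<forall>x \<in> A. a < x" and "i < p" "j < p"
  shows "eoc_pair (ins_leaf a j ts) i =
    (if j < i then eoc_pair ts (i - 1) else if Suc i < j then eoc_pair ts i else a)"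
proof -
  have len: "length ts = p" using ts \<open>i < p\<close> by (simp add: forests_length)
  have val: "a < value (ts ! q)" if "q < p" "ts ! q \<noteq> Leaf" for q
    using forests_value[OF ts, of q] that A by auto
  have nth: "ins_leaf a j ts ! q =
      (if q < j then ts ! q else if q = j then Node Leaf a Leaf else ts ! (q - 1))" if "q \<le> p" for q
    using that \<open>j < p\<close> len by (simp add: ins_leaf_nth)
  have full: "ts ! i \<noteq> Leaf" if "Suc i \<le> j"
    using full_not_Leaf[OF forests_full[OF ts, of i]] that \<open>j < p\<close> by simp
  consider "j < i" | "Suc i < j" | "j = i" | "j = Suc i" by linarith
  then show ?thesis
  proof cases
    case 1
    then show ?thesis using \<open>i < p\<close> by (simp add: nth)
  next
    case 2
    then show ?thesis using \<open>i < p\<close> by (simp add: nth)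
  next
    case 3
    then show ?thesis using \<open>i < p\<close> val[of i] nth[of i] nth[of "Suc i"] by auto
  next
    case 4
    then show ?thesis using \<open>i < p\<close> val[of i] full nth[of i] nth[of "Suc i"] by auto
  qed
qed

text \<open>A new node inside the marked pair has the smaller root label, so the chain enters it and
  goes on with the two trees that it joined; the mark moves to these. Joining trees outside the pair
  only shifts positions.\<close>

lemma eoc_pair_ins_node:
  assumes ts: "ts \<in> forests (Suc p) A" and A: "\<forall>x \<in> A. a < x" and "i < p" "j \<le> p"
  shows "eoc_pair (ins_node a j ts) i =
    (if j < i \<or> j = Suc i then eoc_pair ts (Suc i) else eoc_pair ts i)"
proof -
  have len: "length ts = Suc (Suc p)" using ts by (simp add: forests_length)
  have val: "a < value (ts ! q)" if "q \<le> Suc p" "ts ! q \<noteq> Leaf" for q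
    using forests_value[OF ts, of q] that A by auto
  have nth: "ins_node a j ts ! q =
      (if q < j then ts ! q else if q = j then Node (ts ! j) a (ts ! Suc j) else ts ! Suc q)"
    if "q \<le> p" for q
    using that \<open>j \<le> p\<close> len by (simp add: ins_node_nth)
  have full: "ts ! q \<noteq> Leaf" if "q \<le> p" for q
    using full_not_Leaf[OF forests_full[OF ts, of q]] that by simp
  consider "j < i" | "Suc i < j" | "j = i" | "j = Suc i" by linarith
  then show ?thesis
  proof cases
    case 1
    then show ?thesis using \<open>i < p\<close> by (simp add: nth)
  next
    case 2
    then show ?thesis using \<open>i < p\<close> by (simp add: nth)
  next
    case 3
    have "eoc_pair (ins_node a j ts) i =
        eoc (Node (Node (ts ! i) a (ts ! Suc i)) 0 (ts ! Suc (Suc i)))"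
      using 3 \<open>i < p\<close> nth[of i] nth[of "Suc i"] by (simp del: eoc.simps)
    also have "\<dots> = eoc (Node (ts ! i) a (ts ! Suc i))"
      using val[of "Suc (Suc i)"] \<open>i < p\<close> by (subst eoc.simps(2)) (auto simp del: eoc.simps)
    also have "\<dots> = eoc_pair ts i" by (rule eoc_root_irrelevant) (use full \<open>i < p\<close> in simp)
    finally show ?thesis using 3 by simp
  next
    case 4
    have "eoc_pair (ins_node a j ts) i =
        eoc (Node (ts ! i) 0 (Node (ts ! Suc i) a (ts ! Suc (Suc i))))"
      using 4 \<open>i < p\<close> nth[of i] nth[of "Suc i"] by (simp del: eoc.simps)
    also have "\<dots> = eoc (Node (ts ! Suc i) a (ts ! Suc (Suc i)))"
      using val[of i] full[of i] \<open>i < p\<close> by (subst eoc.simps(2)) (simp del: eoc.simps)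
    also have "\<dots> = eoc_pair ts (Suc i)"
      by (rule eoc_root_irrelevant) (use full \<open>i < p\<close> in simp)
    finally show ?thesis using 4 by simp
  qed
qed

definition ends_at :: "nat \<Rightarrow> nat \<Rightarrow> nat tree list set" where
  "ends_at m i = {ts. eoc_pair ts i = m}"

text \<open>For a fixed mark the recursion involves the neighbouring marks and is not yet
  \<open>W\<close>; only the sum over all marks will be. Since \<open>a < m\<close>, a new leaf
  inside the pair contributes \<open>0\<close>. Carrying \<open>Q\<close> along allows
  \<open>pom\<close> to be fixed at the same time.\<close>

lemma card_ends_at_step:
  assumes "a < m" "a < b" "removable Q a" "i < p"
  defines "h \<equiv> \<lambda>p i. card (forests p {Suc a..<b} \<inter> (ends_at m i \<inter> Q))"
  shows "card (forests p {a..<b} \<inter> (ends_at m i \<inter> Q)) =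
    (\<Sum>j<p. if j < i then h (p - 1) (i - 1) else if Suc i < j then h (p - 1) i else 0) +
    (\<Sum>j\<le>p. if j < i \<or> j = Suc i then h (Suc p) (Suc i) else h (Suc p) i)"
proof -
  let ?A = "{Suc a..<b}"
  have lt: "\<forall>x \<in> ?A. a < x" by auto
  have leaf: "{ts \<in> forests (p - 1) ?A. ins_leaf a j ts \<in> ends_at m i \<inter> Q} =
    (if j < i then forests (p - 1) ?A \<inter> (ends_at m (i - 1) \<inter> Q)
     else if Suc i < j then forests (p - 1) ?A \<inter> (ends_at m i \<inter> Q) else {})"
    if "j < p" for j
  proof -
    have "ins_leaf a j ts \<in> Q \<longleftrightarrow> ts \<in> Q" if "ts \<in> forests (p - 1) ?A" for ts
      using assms(3) \<open>j < p\<close> that by (simp add: removable_def forests_length)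
    moreover note eoc_pair_ins_leaf[OF _ lt \<open>i < p\<close> \<open>j < p\<close>]
    ultimately show ?thesis
      using \<open>a < m\<close> by (auto simp: ends_at_def simp del: eoc.simps split: if_splits)
  qed
  have node: "{ts \<in> forests (Suc p) ?A. ins_node a j ts \<in> ends_at m i \<inter> Q} =
    forests (Suc p) ?A \<inter> (ends_at m (if j < i \<or> j = Suc i then Suc i else i) \<inter> Q)"
    if "j \<le> p" for j
  proof -
    have "ins_node a j ts \<in> Q \<longleftrightarrow> ts \<in> Q" if "ts \<in> forests (Suc p) ?A" for ts
      using assms(3) \<open>j \<le> p\<close> that by (simp add: removable_def forests_length)
    moreover note eoc_pair_ins_node[OF _ lt \<open>i < p\<close> \<open>j \<le> p\<close>]
    ultimately show ?thesis
      by (auto simp: ends_at_def simp del: eoc.simps split: if_splits)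
  qed
  have "card (forests p {a..<b} \<inter> (ends_at m i \<inter> Q)) =
    card {ts \<in> forests p {a..<b}. ts \<in> ends_at m i \<inter> Q}" by (simp add: Int_def)
  also have "\<dots> =
    (\<Sum>j<p. card {ts \<in> forests (p - 1) ?A. ins_leaf a j ts \<in> ends_at m i \<inter> Q}) +
    (\<Sum>j\<le>p. card {ts \<in> forests (Suc p) ?A. ins_node a j ts \<in> ends_at m i \<inter> Q})"
    by (rule card_forests_step[OF \<open>a < b\<close>])
  also have "(\<Sum>j<p. card {ts \<in> forests (p - 1) ?A. ins_leaf a j ts \<in> ends_at m i \<inter> Q}) =
    (\<Sum>j<p. if j < i then h (p - 1) (i - 1) else if Suc i < j then h (p - 1) i else 0)"
    by (intro sum.cong refl) (simp only: leaf lessThan_iff h_def, simp)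
  also have "(\<Sum>j\<le>p. card {ts \<in> forests (Suc p) ?A. ins_node a j ts \<in> ends_at m i \<inter> Q}) =
    (\<Sum>j\<le>p. if j < i \<or> j = Suc i then h (Suc p) (Suc i) else h (Suc p) i)"
    by (intro sum.cong refl) (simp only: node atMost_iff h_def, simp)
  finally show ?thesis .
qed

text \<open>If the smallest label ends the chain, it is a single node at one of the two marked
  places. The last place holds no single node, so for \<open>Suc i = p\<close> only the left one
  remains.\<close>

lemma card_ends_at_min:
  assumes "m < b" "removable Q m" "i < p"
  shows "card (forests p {m..<b} \<inter> (ends_at m i \<inter> Q)) =
    (if Suc i = p then 1 else 2) * card (forests (p - 1) {Suc m..<b} \<inter> Q)"
proof -
  let ?A = "{Suc m..<b}"
  let ?c = "card (forests (p - 1) ?A \<inter> Q)"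
  have lt: "\<forall>x \<in> ?A. m < x" by auto
  have leaf: "{ts \<in> forests (p - 1) ?A. ins_leaf m j ts \<in> ends_at m i \<inter> Q} =
    (if j = i \<or> j = Suc i then forests (p - 1) ?A \<inter> Q else {})" if "j < p" for j
  proof -
    have Q: "ins_leaf m j ts \<in> Q \<longleftrightarrow> ts \<in> Q" if "ts \<in> forests (p - 1) ?A" for ts
      using assms(2) \<open>j < p\<close> that by (simp add: removable_def forests_length)
    have "ins_leaf m j ts \<in> ends_at m i \<longleftrightarrow> j = i \<or> j = Suc i"
      if ts: "ts \<in> forests (p - 1) ?A" for ts
    proof -
      have ne: "eoc_pair ts q \<noteq> m" if "q < p - 1" for q
        using eoc_pair_in[OF ts that] by auto
      have "j < i \<Longrightarrow> eoc_pair ts (i - 1) \<noteq> m" "Suc i < j \<Longrightarrow> eoc_pair ts i \<noteq> m"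
        using \<open>i < p\<close> \<open>j < p\<close> by (intro ne; linarith)+
      then show ?thesis
        using eoc_pair_ins_leaf[OF ts lt \<open>i < p\<close> \<open>j < p\<close>]
        by (auto simp: ends_at_def simp del: eoc.simps)
    qed
    then show ?thesis using Q by auto
  qed
  \<comment> \<open>After joining, the chain ends at a label of \<open>?A\<close>, and these all
    exceed \<open>m\<close>.\<close>
  have node: "{ts \<in> forests (Suc p) ?A. ins_node m j ts \<in> ends_at m i \<inter> Q} = {}"
    if "j \<le> p" for j
    using eoc_pair_ins_node[OF _ lt \<open>i < p\<close> that] eoc_pair_in[of _ "Suc p" ?A i]
      eoc_pair_in[of _ "Suc p" ?A "Suc i"] \<open>i < p\<close>
    by (fastforce simp: ends_at_def simp del: eoc.simps split: if_splits)
  have "card (forests p {m..<b} \<inter> (ends_at m i \<inter> Q)) =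
    card {ts \<in> forests p {m..<b}. ts \<in> ends_at m i \<inter> Q}" by (simp add: Int_def)
  also have "\<dots> =
    (\<Sum>j<p. card {ts \<in> forests (p - 1) ?A. ins_leaf m j ts \<in> ends_at m i \<inter> Q}) +
    (\<Sum>j\<le>p. card {ts \<in> forests (Suc p) ?A. ins_node m j ts \<in> ends_at m i \<inter> Q})"
    by (rule card_forests_step[OF \<open>m < b\<close>])
  also have "(\<Sum>j\<le>p. card {ts \<in> forests (Suc p) ?A. ins_node m j ts \<in> ends_at m i \<inter> Q}) = 0"
    by (intro sum.neutral ballI) (simp only: node atMost_iff card.empty)
  also have "(\<Sum>j<p. card {ts \<in> forests (p - 1) ?A. ins_leaf m j ts \<in> ends_at m i \<inter> Q}) =
      (\<Sum>j<p. if j \<in> {i, Suc i} then ?c else 0)"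
    by (intro sum.cong refl) (simp only: leaf lessThan_iff, simp)
  also have "\<dots> = (\<Sum>j\<in>{..<p} \<inter> {i, Suc i}. ?c)"
    by (rule sum.inter_restrict[symmetric]) simp
  also have "{..<p} \<inter> {i, Suc i} = (if Suc i = p then {i} else {i, Suc i})"
    using \<open>i < p\<close> by auto
  finally show ?thesis by simp
qed

text \<open>Collect equal values: \<open>h i\<close> arises \<open>i + 1\<close> times from row
  \<open>i + 1\<close> and \<open>p - 2 - i\<close> times from row \<open>i\<close>, in total
  \<open>p - 1\<close> times for every \<open>i\<close>.\<close>

lemma sum_leaf_shift:
  fixes h :: "nat \<Rightarrow> nat"
  shows "(\<Sum>i<p. \<Sum>j<p. if j < i then h (i - 1) else if Suc i < j then h i else 0) =
    (p - 1) * (\<Sum>i<p - 1. h i)"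
proof (cases p)
  case (Suc n)
  have inner: "(\<Sum>j<Suc n. if j < i then h (i - 1) else if Suc i < j then h i else 0) =
      i * h (i - 1) + (n - Suc i) * h i" if "i \<le> n" for i
  proof -
    have "(\<Sum>j<Suc n. if j < i then h (i - 1) else if Suc i < j then h i else 0) =
      (\<Sum>j\<in>{..<Suc n} \<inter> {j. j < i}. h (i - 1)) +
      (\<Sum>j\<in>({..<Suc n} \<inter> - {j. j < i}) \<inter> {j. Suc i < j}. h i)"
      by (simp add: sum.If_cases del: sum.lessThan_Suc)
    also have "{..<Suc n} \<inter> {j. j < i} = {..<i}" using that by auto
    also have "({..<Suc n} \<inter> - {j. j < i}) \<inter> {j. Suc i < j} = {Suc (Suc i)..n}" by auto
    finally show ?thesis by simp
  qed
  have "(\<Sum>i<Suc n. i * h (i - 1) + (n - Suc i) * h i) =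
      (\<Sum>i<n. Suc i * h i) + (\<Sum>i<n. (n - Suc i) * h i)"
  proof -
    have "(\<Sum>i<Suc n. i * h (i - 1)) = (\<Sum>i<n. Suc i * h i)"
      by (subst sum.lessThan_Suc_shift) simp
    then show ?thesis by (simp add: sum.distrib)
  qed
  also have "\<dots> = (\<Sum>i<n. (Suc i + (n - Suc i)) * h i)"
    by (simp only: sum.distrib add_mult_distrib)
  also have "\<dots> = n * (\<Sum>i<n. h i)" by (simp add: sum_distrib_left)
  finally show ?thesis using Suc inner by simp
qed simp

text \<open>Here \<open>h i\<close> arises \<open>i\<close> times from row \<open>i - 1\<close> and
  \<open>p - i\<close> times from row \<open>i\<close>. That the total does not depend on
  \<open>i\<close> is what makes the sum over all marks evolve by \<open>W\<close>.\<close>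

lemma sum_node_shift:
  fixes h :: "nat \<Rightarrow> nat"
  shows "(\<Sum>i<p. \<Sum>j\<le>p. if j < i \<or> j = Suc i then h (Suc i) else h i) = p * (\<Sum>i\<le>p. h i)"
proof -
  have inner: "(\<Sum>j\<le>p. if j < i \<or> j = Suc i then h (Suc i) else h i) =
      Suc i * h (Suc i) + (p - i) * h i" if "i < p" for i
  proof -
    have "(\<Sum>j\<le>p. if j < i \<or> j = Suc i then h (Suc i) else h i) =
      (\<Sum>j\<in>insert (Suc i) {..<i}. h (Suc i)) + (\<Sum>j\<in>insert i {Suc (Suc i)..p}. h i)"
    proof -
      have "{..p} \<inter> {j. j < i \<or> j = Suc i} = insert (Suc i) {..<i}"
        "{..p} \<inter> - {j. j < i \<or> j = Suc i} = insert i {Suc (Suc i)..p}" using that by auto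
      then show ?thesis by (simp only: sum.If_cases finite_atMost)
    qed
    moreover have "p - i = Suc (p - Suc i)" using that by simp
    ultimately show ?thesis by simp
  qed
  have "(\<Sum>i<p. Suc i * h (Suc i) + (p - i) * h i) =
      (\<Sum>i\<le>p. i * h i) + (\<Sum>i\<le>p. (p - i) * h i)"
  proof -
    have "(\<Sum>i\<le>p. i * h i) = (\<Sum>i<p. Suc i * h (Suc i))"
      by (subst sum.atMost_shift) simp
    moreover have "(\<Sum>i\<le>p. (p - i) * h i) = (\<Sum>i<p. (p - i) * h i)"
      by (simp flip: lessThan_Suc_atMost)
    ultimately show ?thesis by (simp only: sum.distrib)
  qed
  also have "\<dots> = (\<Sum>i\<le>p. (i + (p - i)) * h i)"
    by (simp only: sum.distrib add_mult_distrib)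
  also have "\<dots> = p * (\<Sum>i\<le>p. h i)" by (simp add: sum_distrib_left)
  finally show ?thesis using inner by simp
qed


text \<open>A forest with \<open>q + 1\<close> full trees has \<open>q + 1\<close> adjacent pairs,
  hence the shift from \<open>Suc q\<close> to evaluation at \<open>q\<close>. When \<open>m\<close>
  is removed, the first \<open>q\<close> marks count twice and the last one once, which gives
  \<open>D\<close>.\<close>

lemma sum_card_ends_at:
  assumes "a \<le> m" "m < b" "\<forall>x \<in> {a..m}. removable Q x"
  shows "(\<Sum>i\<le>q. card (forests (Suc q) {a..<b} \<inter> (ends_at m i \<inter> Q))) =
    (W ^^ (m - a)) (D (\<lambda>p. card (forests p {Suc m..<b} \<inter> Q))) q"
  using assms
proof (induction "m - a" arbitrary: a q)
  case 0
  let ?c = "card (forests q {Suc m..<b} \<inter> Q)"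
  from 0 have "a = m" by simp
  then have "(\<Sum>i\<le>q. card (forests (Suc q) {a..<b} \<inter> (ends_at m i \<inter> Q))) =
      (\<Sum>i\<le>q. (if i = q then 1 else 2) * ?c)"
    using 0 by (intro sum.cong refl) (auto simp: card_ends_at_min)
  also have "\<dots> = (2 * q + 1) * ?c" by (simp add: lessThan_Suc_atMost[symmetric])
  finally show ?case using \<open>a = m\<close> by (simp add: D_def)
next
  case (Suc n)
  then have am: "a < m" by simp
  define h where "h p i = card (forests p {Suc a..<b} \<inter> (ends_at m i \<inter> Q))" for p i
  have IH: "(\<Sum>i\<le>q. h (Suc q) i) = (W ^^ n) (D (\<lambda>p. card (forests p {Suc m..<b} \<inter> Q))) q" for q
  proof -
    have "n = m - Suc a" using Suc.hyps(2) by simp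
    with Suc.hyps(1)[of "Suc a"] am Suc.prems show ?thesis by (simp add: h_def)
  qed
  have "(\<Sum>i\<le>q. card (forests (Suc q) {a..<b} \<inter> (ends_at m i \<inter> Q))) =
      (\<Sum>i<Suc q. (\<Sum>j<Suc q. if j < i then h q (i - 1) else if Suc i < j then h q i else 0) +
        (\<Sum>j\<le>Suc q. if j < i \<or> j = Suc i then h (Suc (Suc q)) (Suc i) else h (Suc (Suc q)) i))"
    unfolding lessThan_Suc_atMost[symmetric, of q] h_def
    using am Suc.prems by (intro sum.cong refl, subst card_ends_at_step) (simp_all cong: if_cong)
  \<comment> \<open>With \<open>p = Suc q\<close> the two shift lemmas give \<open>q\<close> and
    \<open>q + 1\<close>, the coefficients of \<open>W\<close> at \<open>q\<close>.\<close>
  also have "\<dots> = q * (\<Sum>i<q. h q i) + Suc q * (\<Sum>i\<le>Suc q. h (Suc (Suc q)) i)"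
    unfolding sum.distrib sum_leaf_shift sum_node_shift by simp
  also have "\<dots> = W (\<lambda>p. \<Sum>i\<le>p. h (Suc p) i) q"
    by (cases q) (simp_all add: W_def lessThan_Suc_atMost del: sum.lessThan_Suc sum.atMost_Suc)
  finally show ?case by (simp add: IH flip: Suc.hyps(2))
qed

section \<open>Complete increasing trees as forests with a single entry\<close>

lemma subtrees_Node_all:
  "(\<forall>l' a' r'. Node l' a' r' \<in> subtrees (Node l a r) \<longrightarrow> P l' a' r') \<longleftrightarrow>
    P l a r \<and> (\<forall>l' a' r'. Node l' a' r' \<in> subtrees l \<longrightarrow> P l' a' r') \<and>
    (\<forall>l' a' r'. Node l' a' r' \<in> subtrees r \<longrightarrow> P l' a' r')"
  by auto

text \<open>Transitivity extends the comparison with children to all descendants, and distinctness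
  makes the weak order of \<open>heap\<close> strict.\<close>

lemma increasing_iff_heap:
  fixes t :: "nat tree"
  assumes "distinct (inorder t)"
  shows "(\<forall>l a r. Node l a r \<in> subtrees t \<longrightarrow> (\<forall>c \<in> child_labels (Node l a r). a < c)) \<longleftrightarrow> heap t"
  using assms
proof (induction t)
  case (Node l a r)
  have child: "(\<forall>x \<in> set_tree u. a \<le> x) \<longleftrightarrow> (\<forall>u1 c u2. u = Node u1 c u2 \<longrightarrow> a < c)"
    if "heap u" "a \<notin> set_tree u" for u
    using that by (cases u) (auto simp: order.strict_iff_order intro: order_trans)
  have "heap l \<and> heap r \<Longrightarrow>
    (\<forall>x \<in> set_tree l \<union> set_tree r. a \<le> x) \<longleftrightarrow> (\<forall>c \<in> child_labels (Node l a r). a < c)"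
    using child[of l] child[of r] Node.prems
    by (auto simp: child_labels_iff simp del: child_labels.simps)
  then show ?case
    unfolding subtrees_Node_all using Node by (auto simp del: child_labels.simps)
qed simp

lemma full_iff:
  "full t \<longleftrightarrow> t \<noteq> Leaf \<and> (\<forall>l a r. Node l a r \<in> subtrees t \<longrightarrow>
     l = Leaf \<and> r = Leaf \<or> l \<noteq> Leaf \<and> r \<noteq> Leaf)"
proof (induction t)
  case (Node l a r)
  show ?case
    unfolding subtrees_Node_all using Node by (cases "l = Leaf"; cases "r = Leaf") auto
qed simp

lemma rightmost_in_set: "t \<noteq> Leaf \<Longrightarrow> rightmost t \<in> set_tree t"
  by (induction t) auto

lemma secant_shape_iff:
  assumes "distinct (inorder t)" "t \<noteq> Leaf"
  shows "secant_shape t \<longleftrightarrow> (\<forall>l a r. Node l a r \<in> subtrees t \<longrightarrow>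
     (if a = rightmost t then l \<noteq> Leaf \<and> r = Leaf
      else l = Leaf \<and> r = Leaf \<or> l \<noteq> Leaf \<and> r \<noteq> Leaf))"
  using assms
proof (induction t)
  case (Node l a r)
  define P where "P x l a r \<longleftrightarrow> (if a = x then l \<noteq> Leaf \<and> r = Leaf
      else l = Leaf \<and> r = Leaf \<or> l \<noteq> Leaf \<and> r \<noteq> Leaf)" for x a :: 'a and l r :: "'a tree"
  \<comment> \<open>The exceptional label does not occur in \<open>l\<close>, so there the condition
    is plain fullness.\<close>
  have full: "(\<forall>l' a' r'. Node l' a' r' \<in> subtrees l \<longrightarrow> P x l' a' r') \<and> l \<noteq> Leaf \<longleftrightarrow> full l"
    if "x \<notin> set_tree l" for x
  proof -
    have "a' \<noteq> x" if "Node l' a' r' \<in> subtrees l" for l' a' r'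
      using in_set_tree_if[OF that] \<open>x \<notin> set_tree l\<close> by auto
    then show ?thesis unfolding full_iff P_def by (metis (no_types, lifting))
  qed
  have IH: "secant_shape r \<longleftrightarrow>
      (\<forall>l' a' r'. Node l' a' r' \<in> subtrees r \<longrightarrow> P (rightmost r) l' a' r')" if "r \<noteq> Leaf"
    using Node.IH(2) Node.prems that by (simp add: P_def)
  have "secant_shape (Node l a r) \<longleftrightarrow>
    (\<forall>l' a' r'. Node l' a' r' \<in> subtrees (Node l a r) \<longrightarrow> P (rightmost (Node l a r)) l' a' r')"
  proof (cases "r = Leaf")
    case True
    have "a \<notin> set_tree l" using Node.prems by simp
    moreover have "P a l a r \<longleftrightarrow> l \<noteq> Leaf" using True by (simp add: P_def)
    ultimately show ?thesis unfolding subtrees_Node_all using full[of a] True by auto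
  next
    case False
    then have "rightmost r \<in> set_tree r" by (rule rightmost_in_set)
    then have "rightmost r \<noteq> a" "rightmost r \<notin> set_tree l" using Node.prems by auto
    moreover from this have "P (rightmost r) l a r \<longleftrightarrow> l \<noteq> Leaf" using False by (simp add: P_def)
    ultimately show ?thesis
      unfolding subtrees_Node_all using full[of "rightmost r"] IH False by auto
  qed
  then show ?case by (simp only: P_def)
qed simp

text \<open>With \<open>p = 0\<close> only the last place exists. Bijectivity is expressed by the
  size on one side and by distinctness on the other, and the root label \<open>1\<close> follows
  from the heap order.\<close>

lemma CIT_iff_forest:
  assumes "even N" "N > 0"
  shows "t \<in> CIT N \<longleftrightarrow> [t] \<in> forests 0 {1..<Suc N}"
proof -
  let ?incr = "\<forall>l a r. Node l a r \<in> subtrees t \<longrightarrow> (\<forall>c \<in> child_labels (Node l a r). a < c)"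
  have size: "size t = N \<and> set_tree t = {1..N} \<longleftrightarrow> distinct (inorder t) \<and> set_tree t = {1..N}"
    using distinct_card[of "inorder t"] card_distinct[of "inorder t"] by auto
  have not_Leaf: "t \<noteq> Leaf" if "set_tree t = {1..N}" using that assms by auto
  have root: "value t = 1" if heap: "heap t" and set: "set_tree t = {1..N}"
  proof -
    obtain l a r where t: "t = Node l a r" using not_Leaf[OF set] by (cases t) auto
    have "1 \<in> set_tree t" using set assms(2) by simp
    then have "a \<le> 1" using heap unfolding t by auto
    moreover have "a \<in> set_tree t" by (simp add: t)
    then have "1 \<le> a" unfolding set by simp
    ultimately show ?thesis by (simp add: t)
  qed
  have complete: "complete_tree t \<longleftrightarrow> secant_shape t"
    if "size t = N" "distinct (inorder t)" "t \<noteq> Leaf"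
    unfolding complete_tree_def secant_shape_iff[OF that(2,3)] using that(1) assms(1) by simp
  have "t \<in> CIT N \<longleftrightarrow> t \<noteq> Leaf \<and> value t = 1 \<and> ?incr \<and> (size t = N \<and> set_tree t = {1..N}) \<and>
      complete_tree t"
    unfolding CIT_def increasing_tree_def by blast
  also have "\<dots> \<longleftrightarrow> heap t \<and> secant_shape t \<and> distinct (inorder t) \<and> set_tree t = {1..N}"
    using size not_Leaf root complete increasing_iff_heap[of t] by meson
  also have "\<dots> \<longleftrightarrow> [t] \<in> forests 0 {1..<Suc N}"
    unfolding atLeastLessThanSuc_atLeastAtMost by (auto simp: forests_def)
  finally show ?thesis .
qed

lemma parent_not_root: "parent t k c \<Longrightarrow> distinct (inorder t) \<Longrightarrow> c \<noteq> value t"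
  by (cases t) (auto simp: child_labels_iff dest: parent_in_set simp del: child_labels.simps)

lemma parent_unique:
  assumes "distinct (inorder t)" "parent t k c" "parent t k' c"
  shows "k = k'"
  using assms
proof (induction t)
  case (Node l a r)
  have dis: "set_tree l \<inter> set_tree r = {}" "distinct (inorder l)" "distinct (inorder r)"
    using Node.prems by auto
  have not_inner: "\<not> parent l i c \<and> \<not> parent r i c" if "c \<in> child_labels (Node l a r)" for i
    using that parent_not_root[of l i c] parent_not_root[of r i c] parent_in_set[of l i c]
      parent_in_set[of r i c] dis
    by (auto simp: child_labels_iff simp del: child_labels.simps)
  show ?case
    using Node.prems(2,3) Node.IH not_inner dis parent_in_set[of l _ c] parent_in_set[of r _ c]
    by (auto simp del: child_labels.simps)
qed simp

lemma parent_exists: "c \<in> set_tree t \<Longrightarrow> c \<noteq> value t \<Longrightarrow> \<exists>k. parent t k c"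
proof (induction t)
  case (Node l a r)
  have *: "c \<in> child_labels (Node l a r) \<or> (\<exists>k. parent u k c)"
    if "u = l \<or> u = r" "c \<in> set_tree u" "c \<in> set_tree u \<Longrightarrow> c \<noteq> value u \<Longrightarrow> \<exists>k. parent u k c" for u
    using that by (cases u) (auto simp: child_labels_iff simp del: child_labels.simps)
  show ?case using *[of l] *[of r] Node by (auto simp del: child_labels.simps)
qed simp

lemma CIT_props:
  assumes "even N" "N > 0" "t \<in> CIT N"
  shows "distinct (inorder t)" "heap t" "set_tree t = {1..N}" "size t = N" "value t = 1"
    "secant_shape t"
  using assms(3) CIT_iff_forest[OF assms(1,2), of t]
  by (auto simp: forests_def CIT_def increasing_tree_def simp del: child_labels.simps)

lemma pom_iff:
  assumes "even N" "N > 0" "t \<in> CIT N"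
  shows "pom t = k \<longleftrightarrow> [t] \<in> has_parent N k"
proof -
  note t = CIT_props[OF assms]
  \<comment> \<open>The root has label \<open>1\<close>, so \<open>N\<close> is not the root and has
    a parent.\<close>
  have "N \<noteq> 1" using assms by auto
  then obtain k\<^sub>0 where k\<^sub>0: "parent t k\<^sub>0 N" using parent_exists[of N t] t assms(2) by auto
  have "pom t = k\<^sub>0"
    unfolding pom_def parent_iff[symmetric] t(4) using k\<^sub>0 parent_unique[OF t(1)]
    by (intro the_equality) auto
  then show ?thesis using k\<^sub>0 parent_unique[OF t(1), of k\<^sub>0 N k] by (auto simp: has_parent_def)
qed

lemma pom_range:
  assumes "even N" "N > 0" "t \<in> CIT N"
  shows "pom t \<in> {1..N - 1}"
proof -
  have p: "parent t (pom t) N" using pom_iff[OF assms, of "pom t"] by (simp add: has_parent_def)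
  have "pom t \<in> {1..N}" using parent_in_set[OF p] unfolding CIT_props(3)[OF assms] by simp
  moreover have "pom t < N"
    using p assms(3) unfolding parent_iff CIT_def increasing_tree_def by blast
  ultimately show ?thesis by auto
qed

lemma eoc_range:
  assumes "even N" "N > 0" "t \<in> CIT N"
  shows "eoc t \<in> {2..N}"
proof -
  note t = CIT_props[OF assms]
  obtain l r where lr: "t = Node l 1 r" using t(3,5) assms(2) by (cases t) auto
  then have "l \<noteq> Leaf" using t(6) by auto
  then have "eoc t \<in> set_tree l \<union> set_tree r"
    using eoc_in_set[of l] eoc_in_set[of r] lr by auto
  moreover have "1 \<notin> set_tree l \<union> set_tree r" using t(1) lr by auto
  moreover have "eoc t \<in> {1..N}" using eoc_in_set[of t] t(3) lr by auto
  ultimately show ?thesis by (cases "eoc t = 1") auto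
qed

section \<open>Formulas for \<open>f\<close> and its marginals in terms of \<open>W\<close> and
  \<open>D\<close>\<close>

lemma card_CIT:
  assumes "even N" "N > 0"
  shows "card {t \<in> CIT N. P [t]} = card {ts \<in> forests 0 {1..<Suc N}. P ts}"
proof -
  have "{ts \<in> forests 0 {1..<Suc N}. P ts} = (\<lambda>t. [t]) ` {t \<in> CIT N. P [t]}"
  proof -
    have "\<exists>t. ts = [t]" if "ts \<in> forests 0 {1..<Suc N}" for ts
      using forests_length[OF that] by (auto simp: length_Suc_conv)
    then show ?thesis using CIT_iff_forest[OF assms] by blast
  qed
  then show ?thesis by (simp add: card_image inj_on_def)
qed

text \<open>Removing the root \<open>1\<close> leaves two trees, whose only adjacent pair carries
  the mark. So \<open>sum_card_ends_at\<close> applies at \<open>q = 0\<close>, where the sum has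
  one term.\<close>

lemma card_CIT_eoc:
  assumes "even N" "2 \<le> m" "m \<le> N" "\<forall>x \<in> {1..m}. removable Q x"
  shows "card {t \<in> CIT N. eoc t = m \<and> [t] \<in> Q} =
    (W ^^ (m - 2)) (D (\<lambda>p. card (forests p {Suc m..<Suc N} \<inter> Q))) 0"
proof -
  have N: "N > 0" using assms by simp
  have "card {t \<in> CIT N. eoc t = m \<and> [t] \<in> Q} =
      card {ts \<in> forests 0 {1..<Suc N}. eoc (ts ! 0) = m \<and> ts \<in> Q}"
    using card_CIT[OF assms(1) N, of "\<lambda>ts. eoc (ts ! 0) = m \<and> ts \<in> Q"] by simp
  also have "\<dots> = card {ts \<in> forests 1 {2..<Suc N}.
      eoc (ins_node 1 0 ts ! 0) = m \<and> ins_node 1 0 ts \<in> Q}"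
    using card_forests_step[of 1 "Suc N" 0 "\<lambda>ts. eoc (ts ! 0) = m \<and> ts \<in> Q"] N
    by (simp add: numeral_2_eq_2)
  also have "{ts \<in> forests 1 {2..<Suc N}. eoc (ins_node 1 0 ts ! 0) = m \<and> ins_node 1 0 ts \<in> Q} =
      forests 1 {2..<Suc N} \<inter> (ends_at m 0 \<inter> Q)"
  proof -
    have "(eoc (ins_node 1 0 ts ! 0) = m \<and> ins_node 1 0 ts \<in> Q) \<longleftrightarrow> ts \<in> ends_at m 0 \<inter> Q"
      if ts: "ts \<in> forests 1 {2..<Suc N}" for ts
    proof -
      have len: "length ts = 2" using ts by (simp add: forests_length)
      have "ts ! 0 \<noteq> Leaf" using forests_full[OF ts, of 0] by auto
      then have "eoc (ins_node 1 0 ts ! 0) = eoc_pair ts 0"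
        using len by (simp add: ins_node_nth)
      moreover have "removable Q 1" using assms by simp
      ultimately show ?thesis using len by (simp add: ends_at_def removable_def del: eoc.simps)
    qed
    then show ?thesis by blast
  qed
  also have "card \<dots> = (W ^^ (m - 2)) (D (\<lambda>p. card (forests p {Suc m..<Suc N} \<inter> Q))) 0"
    using sum_card_ends_at[of 2 m "Suc N" Q 0] assms by simp
  finally show ?thesis .
qed

text \<open>Since \<open>m < k\<close>, the condition on the parent of \<open>N\<close> survives the
  removal of all labels up to \<open>m\<close>; \<open>card_forests_parent\<close> then starts from
  \<open>m + 1\<close>.\<close>

lemma f_eq:
  assumes "even N" "2 \<le> m" "m < k" "k < N"
  shows "f N m k = (W ^^ (m - 2)) (D ((W ^^ (k - Suc m)) (D ((W ^^ (N - 1 - k)) e\<^sub>0)))) 0"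
proof -
  have "f N m k = card {t \<in> CIT N. eoc t = m \<and> [t] \<in> has_parent N k}"
    unfolding f_def using pom_iff[of N _ k] assms
    by (intro arg_cong[where f = card]) auto
  also have "\<dots> = (W ^^ (m - 2)) (D (\<lambda>p. card (forests p {Suc m..<Suc N} \<inter> has_parent N k))) 0"
    using assms by (intro card_CIT_eoc) (auto intro!: removable_has_parent)
  finally show ?thesis using assms by (simp add: card_forests_parent)
qed

lemma f_row_eq:
  assumes "even N" "2 \<le> m" "m \<le> N"
  shows "f_row N m = (W ^^ (m - 2)) (D ((W ^^ (N - m)) e\<^sub>0)) 0"
proof -
  have "f_row N m = card (\<Union>k\<in>{1..N - 1}. {t \<in> CIT N. eoc t = m \<and> pom t = k})"
    unfolding f_row_def f_def by (rule card_UN_disjoint[symmetric]) (auto simp: finite_CIT)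
  also have "(\<Union>k\<in>{1..N - 1}. {t \<in> CIT N. eoc t = m \<and> pom t = k}) =
      {t \<in> CIT N. eoc t = m \<and> [t] \<in> UNIV}"
    using pom_range[of N] assms by fastforce
  also have "card \<dots> = (W ^^ (m - 2)) (D (\<lambda>p. card (forests p {Suc m..<Suc N} \<inter> UNIV))) 0"
    using assms by (intro card_CIT_eoc) (auto intro: removable_UNIV)
  also have "(\<lambda>p. card (forests p {Suc m..<Suc N} \<inter> UNIV)) = (W ^^ (N - m)) e\<^sub>0"
    by (simp add: card_forests)
  finally show ?thesis .
qed

lemma f_col_eq:
  assumes "even N" "1 \<le> k" "k < N"
  shows "f_col N k = (W ^^ (k - 1)) (D ((W ^^ (N - 1 - k)) e\<^sub>0)) 0"
proof -
  have N: "N > 0" using assms by simp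
  have "f_col N k = card (\<Union>m\<in>{2..N}. {t \<in> CIT N. eoc t = m \<and> pom t = k})"
    unfolding f_col_def f_def by (rule card_UN_disjoint[symmetric]) (auto simp: finite_CIT)
  also have "(\<Union>m\<in>{2..N}. {t \<in> CIT N. eoc t = m \<and> pom t = k}) =
      {t \<in> CIT N. [t] \<in> has_parent N k}"
    using eoc_range[OF assms(1) N] pom_iff[OF assms(1) N] by blast
  also have "card \<dots> = card (forests 0 {1..<Suc N} \<inter> has_parent N k)"
    using card_CIT[OF assms(1) N, of "\<lambda>ts. ts \<in> has_parent N k"] by (simp add: Int_def)
  finally show ?thesis using assms by (simp add: card_forests_parent)
qed

section \<open>Operator identities and the four claims\<close>

lemma W_scale: "W (\<lambda>p. c * v p) = (\<lambda>p. c * W v p)"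
  by (simp add: W_def fun_eq_iff algebra_simps)

lemma D_scale: "D (\<lambda>p. c * v p) = (\<lambda>p. c * D v p)"
  by (simp add: D_def fun_eq_iff algebra_simps)

lemma W_power_scale: "(W ^^ n) (\<lambda>p. c * v p) = (\<lambda>p. c * (W ^^ n) v p)"
  by (induction n) (simp_all add: W_scale)

lemma D_e0: "D e\<^sub>0 = e\<^sub>0"
  by (simp add: D_def e\<^sub>0_def fun_eq_iff)

text \<open>The support of \<open>W e\<^sub>0\<close> is \<open>p = 1\<close>, where
  \<open>D\<close> multiplies by \<open>3\<close>.\<close>

lemma D_W_e0: "D (W e\<^sub>0) = (\<lambda>p. 3 * W e\<^sub>0 p)"
  by (auto simp: D_def W_def e\<^sub>0_def fun_eq_iff)

lemma D_0: "D v 0 = v 0"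
  by (simp add: D_def)

text \<open>At \<open>0\<close> the operator \<open>W\<close> reads only the value at
  \<open>1\<close>, where \<open>D\<close> multiplies by \<open>3\<close>.\<close>

lemma W_D_0: "W (D v) 0 = 3 * W v 0"
  by (simp add: D_def W_def)

lemma f_row_eq_f_col:
  assumes "even N" "2 \<le> m" "m \<le> N"
  shows "f_row N m = f_col N (m - 1)"
proof -
  have "m - 1 - 1 = m - 2" "N - 1 - (m - 1) = N - m" using assms(2) by simp_all
  moreover have "1 \<le> m - 1" "m - 1 < N" using assms by simp_all
  ultimately show ?thesis
    using f_row_eq[OF assms] f_col_eq[OF assms(1), of "m - 1"] by presburger
qed

text \<open>For \<open>m = 2\<close> the outer \<open>D\<close> is evaluated at \<open>0\<close>,
  where it is the identity; the column formula for \<open>N\<close> remains.\<close>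

lemma f_2:
  assumes "even N" "3 \<le> k" "k \<le> N + 1"
  shows "f (N + 2) 2 k = f_col N (k - 2)"
proof -
  have "k - 2 - 1 = k - Suc 2" "N - 1 - (k - 2) = N + 2 - 1 - k" using assms by simp_all
  moreover have "even (N + 2)" "2 < k" "k < N + 2" "1 \<le> k - 2" "k - 2 < N" using assms by simp_all
  ultimately show ?thesis
    using f_eq[of "N + 2" 2 k] f_col_eq[OF assms(1), of "k - 2"]
    by (simp only: D_0 diff_self_eq_0 funpow_0)
qed

text \<open>By \<open>W_D_0\<close> the outer \<open>D\<close> becomes the factor \<open>3\<close>,
  and the \<open>W\<close> in front of it joins the next power, giving the word for
  \<open>m = 2\<close>.\<close>

lemma f_3:
  assumes "even N" "4 \<le> k" "k \<le> N + 1"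
  shows "f (N + 2) 3 k = 3 * f (N + 2) 2 k"
proof -
  have "k - Suc 2 = Suc (k - Suc 3)" "3 - 2 = Suc 0" using assms by simp_all
  moreover have "even (N + 2)" "2 < k" "3 < k" "k < N + 2" using assms by simp_all
  ultimately show ?thesis
    using f_eq[of "N + 2" 2 k] f_eq[of "N + 2" 3 k]
    by (simp add: D_0 W_D_0)
qed

text \<open>The inner \<open>D\<close> acts on \<open>e\<^sub>0\<close> and disappears, which leaves
  the row formula for \<open>N\<close>.\<close>

lemma f_last:
  assumes "even N" "2 \<le> m" "m \<le> N"
  shows "f (N + 2) m (N + 1) = f_row N m"
proof -
  have "N + 1 - Suc m = N - m" "N + 2 - 1 - (N + 1) = 0" by simp_all
  moreover have "even (N + 2)" "m < N + 1" "N + 1 < N + 2" using assms by simp_all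
  ultimately show ?thesis
    using f_eq[of "N + 2" m "N + 1"] f_row_eq[OF assms] assms(2) by (simp only: D_e0 funpow_0)
qed

text \<open>The inner \<open>D\<close> acts on \<open>W e\<^sub>0\<close> and gives
  \<open>3\<close>, which linearity moves to the front.\<close>

lemma f_second_last:
  assumes "even N" "2 \<le> m" "m < N"
  shows "f (N + 2) m N = 3 * f (N + 2) m (N + 1)"
proof -
  let ?r = "N - Suc m"
  have "N + 1 - Suc m = Suc ?r" "N + 2 - 1 - (N + 1) = 0" "N + 2 - 1 - N = Suc 0"
    using assms by simp_all
  moreover have "even (N + 2)" "m < N + 1" "N + 1 < N + 2" "N < N + 2" using assms by simp_all
  ultimately have f: "f (N + 2) m N = (W ^^ (m - 2)) (D ((W ^^ ?r) (D (W e\<^sub>0)))) 0"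
    "f (N + 2) m (N + 1) = (W ^^ (m - 2)) (D ((W ^^ Suc ?r) e\<^sub>0)) 0"
    using f_eq[of "N + 2" m N] f_eq[of "N + 2" m "N + 1"] assms(2,3)
    by (simp_all only: D_e0 funpow_0 funpow.simps o_apply id_apply)
  have "(W ^^ Suc ?r) e\<^sub>0 = (W ^^ ?r) (W e\<^sub>0)" by (simp add: funpow_swap1)
  then show ?thesis unfolding f by (simp only: D_W_e0 W_power_scale D_scale)
qed

theorem theorem1p2:
  fixes n :: nat
  assumes "n \<ge> 2"
  shows "(\<forall>k \<in> {3..2*n-1}. f (2*n) 2 k = f_col (2*n-2) (k-2) \<and>
                           f_col (2*n-2) (k-2) = f_row (2*n-2) (k-1)) \<and>
         (\<forall>k \<in> {4..2*n-1}. f (2*n) 3 k = 3 * f (2*n) 2 k) \<and>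
         (\<forall>m \<in> {2..2*n-2}. f (2*n) m (2*n-1) = f_row (2*n-2) m \<and>
                           f_row (2*n-2) m = f_col (2*n-2) (m-1)) \<and>
         (\<forall>m \<in> {2..2*n-3}. f (2*n) m (2*n-2) = 3 * f (2*n) m (2*n-1))"
proof -
  define N where "N = 2 * n - 2"
  have N: "even N" "2 \<le> N" "2 * n = N + 2" using assms by (auto simp: N_def)
  then have bounds: "2 * n - 1 = N + 1" "2 * n - 2 = N" "2 * n - 3 = N - 1" by simp_all
  have "f (N + 2) 2 k = f_col N (k - 2) \<and> f_col N (k - 2) = f_row N (k - 1)"
    if "k \<in> {3..N + 1}" for k
  proof -
    have "k - 1 - 1 = k - 2" "2 \<le> k - 1" "k - 1 \<le> N" using that by auto
    then show ?thesis using f_2[OF N(1), of k] f_row_eq_f_col[OF N(1), of "k - 1"] that by simp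
  qed
  moreover have "f (N + 2) 3 k = 3 * f (N + 2) 2 k" if "k \<in> {4..N + 1}" for k
    using f_3[OF N(1), of k] that by simp
  moreover have "f (N + 2) m (N + 1) = f_row N m \<and> f_row N m = f_col N (m - 1)"
    if "m \<in> {2..N}" for m
    using f_last[OF N(1), of m] f_row_eq_f_col[OF N(1), of m] that by simp
  moreover have "f (N + 2) m N = 3 * f (N + 2) m (N + 1)" if "m \<in> {2..N - 1}" for m
    using f_second_last[OF N(1), of m] N(2) that by auto
  ultimately show ?thesis unfolding bounds unfolding N(3) by blast
qed

end
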